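(* Let $a,b$ be positive integers, let $J$ be a metallic structure on a smooth manifold $M_n$ (that is, $J^2=aJ+bI$), with associated distributions $L$ and $M$, let $\nabla$ be a linear connection on $M_n$, and let $\hat\nabla$ be the Vrănceanu connection of $(J,\nabla)$. Then the distributions $L$ and $M$ are anti half parallel with respect to $\hat\nabla$.
   Context: All manifolds and tensor fields are $C^\infty$; $\chi(M_n)$ is the Lie algebra of vector fields on the $n$-dimensional manifold $M_n$ and $I$ is the identity; $X\in L$ (resp. $X\in M$) means $X$ is a vector field that is a section of the distribution $L$ (resp. $M$). For positive integers $a,b$, a metallic structure is a $(1,1)$-tensor field $J$ with $J^2=aJ+bI$, and $\rho_{a,b}=\frac{a+\sqrt{a^2+4b}}{2}$. $L$ and $M$ are the complementary eigendistributions of $J$ for the eigenvalues $\rho_{a,b}$ and $a-\rho_{a,b}$ respectively, with projectors $l=\frac{1}{2\rho_{a,b}-a}J-\frac{a-\rho_{a,b}}{2\rho_{a,b}-a}I$ and $m=-\frac{1}{2\rho_{a,b}-a}J+\frac{\rho_{a,b}}{2\rho_{a,b}-a}I$. The Vrănceanu connection is $\hat\nabla_XY=l(\nabla_{lX}lY)+m(\nabla_{mX}mY)+l[mX,lY]+m[lX,mY]$. For a linear connection $D$ put $(\Delta J)(X,Y)=J D_XY-J D_YX-D_{JX}Y+D_Y(JX)$. The distribution $L$ is anti half parallel with respect to $D$ if $(\Delta J)(X,Y)\in M$ for all $X\in L$, $Y\in\chi(M_n)$; the distribution $M$ is anti half parallel with respect to $D$ if $(\Delta J)(X,Y)\in L$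 for all $X\in M$, $Y\in\chi(M_n)$. *)

theory Defs
  imports "HOL-Analysis.Analysis"
begin

text \<open>
  Real-valued functions on a manifold are represented by total functions whose values off the
  manifold are irrelevant; tangent vectors at \<open>p\<close> are derivations at \<open>p\<close> of the algebra of smooth
  functions, and a vector field assigns a tangent vector to each point.
\<close>

type_synonym ('m, 'n) atlas = "('m set \<times> ('m \<Rightarrow> real ^ 'n)) set"
type_synonym 'm tangent = "('m \<Rightarrow> real) \<Rightarrow> real"
type_synonym 'm vfield = "'m \<Rightarrow> 'm tangent"
type_synonym 'm endo_field = "'m \<Rightarrow> 'm tangent \<Rightarrow> 'm tangent"
type_synonym 'm connection = "'m vfield \<Rightarrow> 'm vfield \<Rightarrow> 'm vfield"
type_synonym 'm distribution = "'m \<Rightarrow> 'm tangent set"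


section \<open>Smooth manifolds\<close>

text \<open>Class \<open>C\<^sup>k\<close> on a set; only meant for open sets of a finite-dimensional space.\<close>

primrec Ck_on :: "nat \<Rightarrow> 'a::real_normed_vector set \<Rightarrow> ('a \<Rightarrow> 'b::real_normed_vector) \<Rightarrow> bool" where
  "Ck_on 0 S f \<longleftrightarrow> continuous_on S f"
| "Ck_on (Suc k) S f \<longleftrightarrow> (\<forall>x\<in>S. f differentiable (at x)) \<and>
     (\<forall>v. Ck_on k S (\<lambda>x. frechet_derivative f (at x) v))"

definition smooth_on :: "'a::real_normed_vector set \<Rightarrow> ('a \<Rightarrow> 'b::real_normed_vector) \<Rightarrow> bool" where
  "smooth_on S f \<longleftrightarrow> (\<forall>k. Ck_on k S f)"

definition chart :: "'m topology \<Rightarrow> 'm set \<Rightarrow> ('m \<Rightarrow> real ^ 'n) \<Rightarrow> bool" where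
  "chart T U \<phi> \<longleftrightarrow> openin T U \<and> open (\<phi> ` U) \<and>
     homeomorphic_map (subtopology T U) (top_of_set (\<phi> ` U)) \<phi>"

definition points :: "('m, 'n) atlas \<Rightarrow> 'm set" where
  "points A = (\<Union>(U, \<phi>)\<in>A. U)"

text \<open>The dimension of the manifold is \<open>CARD('n)\<close>. The atlas need not be maximal.\<close>

definition smooth_manifold :: "'m topology \<Rightarrow> ('m, 'n::finite) atlas \<Rightarrow> bool" where
  "smooth_manifold T A \<longleftrightarrow>
     Hausdorff_space T \<and> second_countable T \<and> topspace T = points A \<and>
     (\<forall>(U, \<phi>)\<in>A. chart T U \<phi>) \<and>
     (\<forall>(U, \<phi>)\<in>A. \<forall>(V, \<psi>)\<in>A. smooth_on (\<phi> ` (U \<inter> V)) (\<psi> \<circ> inv_into U \<phi>))"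

definition smooth_functions :: "('m, 'n::finite) atlas \<Rightarrow> ('m \<Rightarrow> real) set" where
  "smooth_functions A = {f. \<forall>(U, \<phi>)\<in>A. smooth_on (\<phi> ` U) (f \<circ> inv_into U \<phi>)}"


section \<open>Vector fields\<close>

text \<open>
  The last condition makes the representation of a tangent vector unique. The value \<open>v f\<close>
  automatically depends only on \<open>f\<close> restricted to the manifold: if a smooth \<open>h\<close> vanishes on the
  manifold and \<open>k\<close> is the indicator function of its complement, then \<open>h = h k\<close> and the Leibniz
  rule gives \<open>v h = 0\<close>.
\<close>

definition tangent_space :: "('m, 'n::finite) atlas \<Rightarrow> 'm \<Rightarrow> 'm tangent set" where
  "tangent_space A p = {v.
     (\<forall>f\<in>smooth_functions A. \<forall>g\<in>smooth_functions A. v (\<lambda>x. f x + g x) = v f + v g) \<and>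
     (\<forall>c. \<forall>f\<in>smooth_functions A. v (\<lambda>x. c * f x) = c * v f) \<and>
     (\<forall>f\<in>smooth_functions A. \<forall>g\<in>smooth_functions A.
        v (\<lambda>x. f x * g x) = f p * v g + g p * v f) \<and>
     (\<forall>f. f \<notin> smooth_functions A \<longrightarrow> v f = 0)}"

definition vector_fields :: "('m, 'n::finite) atlas \<Rightarrow> 'm vfield set" where
  "vector_fields A = {X.
     (\<forall>p\<in>points A. X p \<in> tangent_space A p) \<and>
     (\<forall>p. p \<notin> points A \<longrightarrow> X p = (\<lambda>_. 0)) \<and>
     (\<forall>f\<in>smooth_functions A. (\<lambda>p. X p f) \<in> smooth_functions A)}"

definition vf_add :: "'m vfield \<Rightarrow> 'm vfield \<Rightarrow> 'm vfield" where
  "vf_add X Y = (\<lambda>p f. X p f + Y p f)"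

definition vf_diff :: "'m vfield \<Rightarrow> 'm vfield \<Rightarrow> 'm vfield" where
  "vf_diff X Y = (\<lambda>p f. X p f - Y p f)"

definition vf_mult :: "('m \<Rightarrow> real) \<Rightarrow> 'm vfield \<Rightarrow> 'm vfield" where
  "vf_mult h X = (\<lambda>p f. h p * X p f)"

definition lie_bracket :: "'m vfield \<Rightarrow> 'm vfield \<Rightarrow> 'm vfield" where
  "lie_bracket X Y = (\<lambda>p f. X p (\<lambda>q. Y q f) - Y p (\<lambda>q. X q f))"


section \<open>Tensor fields, connections and distributions\<close>

definition vf_app :: "('m, 'n::finite) atlas \<Rightarrow> 'm endo_field \<Rightarrow> 'm vfield \<Rightarrow> 'm vfield" where
  "vf_app A J X = (\<lambda>p. if p \<in> points A then J p (X p) else (\<lambda>_. 0))"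

text \<open>
  \<open>(1,1)\<close>-tensor fields, i.e. fields of endomorphisms of the tangent spaces; such a field is
  smooth iff it maps smooth vector fields to smooth vector fields.
\<close>

definition tensor_field_1_1 :: "('m, 'n::finite) atlas \<Rightarrow> 'm endo_field \<Rightarrow> bool" where
  "tensor_field_1_1 A J \<longleftrightarrow>
     (\<forall>p\<in>points A. \<forall>v\<in>tangent_space A p. J p v \<in> tangent_space A p) \<and>
     (\<forall>p\<in>points A. \<forall>v\<in>tangent_space A p. \<forall>w\<in>tangent_space A p. \<forall>c d.
        J p (\<lambda>f. c * v f + d * w f) = (\<lambda>f. c * J p v f + d * J p w f)) \<and>
     (\<forall>X\<in>vector_fields A. vf_app A J X \<in> vector_fields A)"

definition linear_connection :: "('m, 'n::finite) atlas \<Rightarrow> 'm connection \<Rightarrow> bool" where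
  "linear_connection A D \<longleftrightarrow>
     (\<forall>X\<in>vector_fields A. \<forall>Y\<in>vector_fields A. D X Y \<in> vector_fields A) \<and>
     (\<forall>X\<in>vector_fields A. \<forall>X'\<in>vector_fields A. \<forall>Y\<in>vector_fields A.
        D (vf_add X X') Y = vf_add (D X Y) (D X' Y)) \<and>
     (\<forall>h\<in>smooth_functions A. \<forall>X\<in>vector_fields A. \<forall>Y\<in>vector_fields A.
        D (vf_mult h X) Y = vf_mult h (D X Y)) \<and>
     (\<forall>X\<in>vector_fields A. \<forall>Y\<in>vector_fields A. \<forall>Y'\<in>vector_fields A.
        D X (vf_add Y Y') = vf_add (D X Y) (D X Y')) \<and>
     (\<forall>h\<in>smooth_functions A. \<forall>X\<in>vector_fields A. \<forall>Y\<in>vector_fields A.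
        D X (vf_mult h Y) = vf_add (vf_mult (\<lambda>p. X p h) Y) (vf_mult h (D X Y)))"

definition sections :: "('m, 'n::finite) atlas \<Rightarrow> 'm distribution \<Rightarrow> 'm vfield set" where
  "sections A E = {X \<in> vector_fields A. \<forall>p\<in>points A. X p \<in> E p}"

definition eigendistribution ::
  "('m, 'n::finite) atlas \<Rightarrow> 'm endo_field \<Rightarrow> real \<Rightarrow> 'm distribution" where
  "eigendistribution A J c = (\<lambda>p. {v \<in> tangent_space A p. J p v = (\<lambda>f. c * v f)})"


section \<open>Metallic structures\<close>

definition metallic_structure ::
  "('m, 'n::finite) atlas \<Rightarrow> nat \<Rightarrow> nat \<Rightarrow> 'm endo_field \<Rightarrow> bool" where
  "metallic_structure A a b J \<longleftrightarrow> tensor_field_1_1 A J \<and>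
     (\<forall>p\<in>points A. \<forall>v\<in>tangent_space A p.
        J p (J p v) = (\<lambda>f. real a * J p v f + real b * v f))"

definition metallic_mean :: "nat \<Rightarrow> nat \<Rightarrow> real" where
  "metallic_mean a b = (real a + sqrt (real a ^ 2 + 4 * real b)) / 2"

definition distr_L :: "('m, 'n::finite) atlas \<Rightarrow> nat \<Rightarrow> nat \<Rightarrow> 'm endo_field \<Rightarrow> 'm distribution" where
  "distr_L A a b J = eigendistribution A J (metallic_mean a b)"

definition distr_M :: "('m, 'n::finite) atlas \<Rightarrow> nat \<Rightarrow> nat \<Rightarrow> 'm endo_field \<Rightarrow> 'm distribution" where
  "distr_M A a b J = eigendistribution A J (real a - metallic_mean a b)"

definition proj_l :: "nat \<Rightarrow> nat \<Rightarrow> 'm endo_field \<Rightarrow> 'm endo_field" where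
  "proj_l a b J = (let \<rho> = metallic_mean a b in
     (\<lambda>p v f. 1 / (2 * \<rho> - real a) * J p v f - (real a - \<rho>) / (2 * \<rho> - real a) * v f))"

definition proj_m :: "nat \<Rightarrow> nat \<Rightarrow> 'm endo_field \<Rightarrow> 'm endo_field" where
  "proj_m a b J = (let \<rho> = metallic_mean a b in
     (\<lambda>p v f. - (1 / (2 * \<rho> - real a)) * J p v f + \<rho> / (2 * \<rho> - real a) * v f))"

definition vranceanu_connection ::
  "('m, 'n::finite) atlas \<Rightarrow> nat \<Rightarrow> nat \<Rightarrow> 'm endo_field \<Rightarrow> 'm connection \<Rightarrow> 'm connection" where
  "vranceanu_connection A a b J D = (\<lambda>X Y.
     let l = vf_app A (proj_l a b J); m = vf_app A (proj_m a b J) in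
     vf_add (vf_add (vf_add
       (l (D (l X) (l Y)))
       (m (D (m X) (m Y))))
       (l (lie_bracket (m X) (l Y))))
       (m (lie_bracket (l X) (m Y))))"

definition Delta ::
  "('m, 'n::finite) atlas \<Rightarrow> 'm endo_field \<Rightarrow> 'm connection \<Rightarrow> 'm vfield \<Rightarrow> 'm vfield \<Rightarrow> 'm vfield" where
  "Delta A J D X Y = (let j = vf_app A J in
     vf_add (vf_diff (vf_diff (j (D X Y)) (j (D Y X))) (D (j X) Y)) (D Y (j X)))"

text \<open>\<open>E\<close> is anti half parallel with respect to \<open>D\<close>, where \<open>E'\<close> is the complementary distribution.\<close>

definition anti_half_parallel ::
  "('m, 'n::finite) atlas \<Rightarrow> 'm endo_field \<Rightarrow> 'm connection \<Rightarrow> 'm distribution \<Rightarrow> 'm distribution \<Rightarrow> bool" where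
  "anti_half_parallel A J D E E' \<longleftrightarrow>
     (\<forall>X\<in>sections A E. \<forall>Y\<in>vector_fields A. Delta A J D X Y \<in> sections A E')"

end

theory Submission
  imports Defs
begin

text \<open>
  Write \<open>c, d\<close> for the two roots \<open>\<rho>\<close> and \<open>a - \<rho>\<close> of \<open>t\<^sup>2 = a t + b\<close>, in either order, so that
  \<open>(J - d) (J - c) = 0\<close>. Let \<open>X\<close> be a section of the eigendistribution for \<open>c\<close>, that is \<open>J X = c X\<close>,
  and let \<open>V\<close> be any binary operation on vector fields that is homogeneous over the \<^emph>\<open>constants\<close> in both
  arguments. Then
  \<open>(\<Delta>J)(X, Y) = J V\<^sub>X Y - J V\<^sub>Y X - c V\<^sub>X Y + c V\<^sub>Y X = (J - c) (V\<^sub>X Y - V\<^sub>Y X)\<close>,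
  and \<open>J - d\<close> kills everything of the form \<open>(J - c) Z\<close>; so \<open>(\<Delta>J)(X, Y)\<close> is a section of the
  eigendistribution for \<open>d\<close>. This is \<open>anti_half_parallel_eigendistributions\<close>.

  The Vranceanu connection is such an operation: it is assembled from the projectors, the
  given connection and Lie brackets, each of which is homogeneous over the constants
  (\<open>vranceanu_connection_scale_left\<close>, \<open>vranceanu_connection_scale_right\<close>). The rest of the work is
  to see that the Lie bracket of two vector fields is again a vector field, which rests on smooth
  functions forming an algebra, that is, on the Leibniz rule for \<open>C\<^sup>k\<close> functions.
\<close>

section \<open>The algebra of smooth functions\<close>

text \<open>
  On an open set the derivative sees only the values on the set; this allows the sum and product
  rules, valid only on the set, to be substituted under \<open>Ck_on\<close>.
\<close>

lemma Ck_on_cong: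
  assumes "open S" and "\<And>x. x \<in> S \<Longrightarrow> f x = g x" and "Ck_on k S f"
  shows "Ck_on k S g"
  using assms(2,3)
proof (induction k arbitrary: f g)
  case 0
  then show ?case using continuous_on_cong[of S S f g] by simp
next
  case (Suc k)
  have deriv: "(g has_derivative frechet_derivative f (at x)) (at x)" if "x \<in> S" for x
  proof -
    have "(f has_derivative frechet_derivative f (at x)) (at x)"
      using Suc.prems(2) that by (simp add: frechet_derivative_works[symmetric])
    then show ?thesis
      using has_derivative_transform_within_open[OF _ assms(1) that] Suc.prems(1) by blast
  qed
  have "Ck_on k S (\<lambda>x. frechet_derivative g (at x) v)" for v
  proof (rule Suc.IH)
    show "Ck_on k S (\<lambda>x. frechet_derivative f (at x) v)"
      using Suc.prems(2) by simp
    show "frechet_derivative f (at x) v = frechet_derivative g (at x) v" if "x \<in> S" for x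
      using frechet_derivative_at[OF deriv[OF that]] by simp
  qed
  then show ?case
    using deriv by (auto simp: differentiable_def)
qed

lemma Ck_on_Suc_imp_Ck_on: "Ck_on (Suc k) S f \<Longrightarrow> Ck_on k S f"
proof (induction k arbitrary: f)
  case 0
  then show ?case
    by (auto intro!: continuous_at_imp_continuous_on differentiable_imp_continuous_within)
next
  case (Suc k)
  then show ?case
    by (metis Ck_on.simps(2))
qed

lemma Ck_on_const: "Ck_on k S (\<lambda>x. c)"
  by (induction k arbitrary: c) (auto simp: frechet_derivative_const)

lemma Ck_on_add:
  assumes "open S" and "Ck_on k S f" and "Ck_on k S g"
  shows "Ck_on k S (\<lambda>x. f x + g x)"
  using assms(2,3)
proof (induction k arbitrary: f g)
  case 0
  then show ?case by (auto intro: continuous_on_add)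
next
  case (Suc k)
  have "Ck_on k S (\<lambda>x. frechet_derivative (\<lambda>x. f x + g x) (at x) v)" for v
  proof (rule Ck_on_cong[OF assms(1)])
    show "Ck_on k S (\<lambda>x. frechet_derivative f (at x) v + frechet_derivative g (at x) v)"
      using Suc by auto
    show "frechet_derivative f (at x) v + frechet_derivative g (at x) v =
        frechet_derivative (\<lambda>x. f x + g x) (at x) v" if "x \<in> S" for x
    proof -
      have "((\<lambda>x. f x + g x) has_derivative
          (\<lambda>v. frechet_derivative f (at x) v + frechet_derivative g (at x) v)) (at x)"
        using Suc.prems that
        by (intro has_derivative_add) (auto simp: frechet_derivative_works[symmetric])
      from frechet_derivative_at[OF this] show ?thesis by metis
    qed
  qed
  then show ?case using Suc.prems by auto
qed

lemma Ck_on_mult: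
  fixes f g :: "'a::real_normed_vector \<Rightarrow> real"
  assumes "open S" and "Ck_on k S f" and "Ck_on k S g"
  shows "Ck_on k S (\<lambda>x. f x * g x)"
  using assms(2,3)
proof (induction k arbitrary: f g)
  case 0
  then show ?case by (auto intro: continuous_on_mult)
next
  case (Suc k)
  have "Ck_on k S (\<lambda>x. frechet_derivative (\<lambda>x. f x * g x) (at x) v)" for v
  proof (rule Ck_on_cong[OF assms(1)])
    show "Ck_on k S (\<lambda>x. f x * frechet_derivative g (at x) v + frechet_derivative f (at x) v * g x)"
      using Suc.prems Suc.prems[THEN Ck_on_Suc_imp_Ck_on]
      by (intro Ck_on_add[OF assms(1)] Suc.IH) auto
    show "f x * frechet_derivative g (at x) v + frechet_derivative f (at x) v * g x =
        frechet_derivative (\<lambda>x. f x * g x) (at x) v" if "x \<in> S" for x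
    proof -
      have "((\<lambda>x. f x * g x) has_derivative
          (\<lambda>v. f x * frechet_derivative g (at x) v + frechet_derivative f (at x) v * g x)) (at x)"
        using Suc.prems that
        by (intro has_derivative_mult) (auto simp: frechet_derivative_works[symmetric])
      from frechet_derivative_at[OF this] show ?thesis by metis
    qed
  qed
  then show ?case using Suc.prems by (auto intro: differentiable_mult)
qed

lemma smooth_manifold_open_chart_image:
  "smooth_manifold T A \<Longrightarrow> (U, \<phi>) \<in> A \<Longrightarrow> open (\<phi> ` U)"
  by (fastforce simp: smooth_manifold_def chart_def)

lemma smooth_functions_const: "(\<lambda>_. c) \<in> smooth_functions A"
  by (auto simp: smooth_functions_def smooth_on_def o_def Ck_on_const)

lemma smooth_functions_add:
  assumes "smooth_manifold T A" and "f \<in> smooth_functions A" and "g \<in> smooth_functions A"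
  shows "(\<lambda>x. f x + g x) \<in> smooth_functions A"
  using assms(2,3) smooth_manifold_open_chart_image[OF assms(1)]
  by (fastforce simp: smooth_functions_def smooth_on_def o_def intro: Ck_on_add)

lemma smooth_functions_mult:
  assumes "smooth_manifold T A" and "f \<in> smooth_functions A" and "g \<in> smooth_functions A"
  shows "(\<lambda>x. f x * g x) \<in> smooth_functions A"
  using assms(2,3) smooth_manifold_open_chart_image[OF assms(1)]
  by (fastforce simp: smooth_functions_def smooth_on_def o_def intro: Ck_on_mult)

lemma smooth_functions_lincomb:
  assumes "smooth_manifold T A" and "f \<in> smooth_functions A" and "g \<in> smooth_functions A"
  shows "(\<lambda>x. c * f x + d * g x) \<in> smooth_functions A"
  using smooth_functions_add[OF assms(1)] smooth_functions_mult[OF assms(1)]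
    smooth_functions_const assms(2,3) by blast


section \<open>Tangent vectors and vector fields\<close>

lemma tangent_space_add:
  "v \<in> tangent_space A p \<Longrightarrow> f \<in> smooth_functions A \<Longrightarrow> g \<in> smooth_functions A \<Longrightarrow>
    v (\<lambda>x. f x + g x) = v f + v g"
  by (simp add: tangent_space_def)

lemma tangent_space_scale:
  "v \<in> tangent_space A p \<Longrightarrow> f \<in> smooth_functions A \<Longrightarrow> v (\<lambda>x. c * f x) = c * v f"
  by (simp add: tangent_space_def)

lemma tangent_space_mult:
  "v \<in> tangent_space A p \<Longrightarrow> f \<in> smooth_functions A \<Longrightarrow> g \<in> smooth_functions A \<Longrightarrow>
    v (\<lambda>x. f x * g x) = f p * v g + g p * v f"
  by (simp add: tangent_space_def)

lemma tangent_space_not_smooth: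
  "v \<in> tangent_space A p \<Longrightarrow> f \<notin> smooth_functions A \<Longrightarrow> v f = 0"
  by (simp add: tangent_space_def)

lemma tangent_space_const:
  assumes "v \<in> tangent_space A p"
  shows "v (\<lambda>_. c) = 0"
proof -
  have "v (\<lambda>_. 1) = 0"
    using tangent_space_mult[OF assms smooth_functions_const[of 1] smooth_functions_const[of 1]]
    by simp
  then show ?thesis
    using tangent_space_scale[OF assms smooth_functions_const[of 1], of c] by simp
qed

lemma tangent_space_lincomb:
  assumes "v \<in> tangent_space A p" and "w \<in> tangent_space A p"
  shows "(\<lambda>f. c * v f + d * w f) \<in> tangent_space A p"
  using assms by (simp add: tangent_space_def algebra_simps)

lemma vector_fields_tangent: "X \<in> vector_fields A \<Longrightarrow> p \<in> points A \<Longrightarrow> X p \<in> tangent_space A p"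
  by (simp add: vector_fields_def)

lemma vector_fields_outside: "X \<in> vector_fields A \<Longrightarrow> p \<notin> points A \<Longrightarrow> X p f = 0"
  by (simp add: vector_fields_def)

lemma vector_fields_const:
  "X \<in> vector_fields A \<Longrightarrow> X p (\<lambda>_. c) = 0"
  by (cases "p \<in> points A")
    (auto simp: vector_fields_outside dest: vector_fields_tangent tangent_space_const)

lemma vector_fields_not_smooth:
  "X \<in> vector_fields A \<Longrightarrow> f \<notin> smooth_functions A \<Longrightarrow> X p f = 0"
  by (cases "p \<in> points A")
    (auto simp: vector_fields_outside dest: vector_fields_tangent tangent_space_not_smooth)

text \<open>
  This holds for every \<open>f\<close>, since non-smooth functions are sent to \<open>0\<close>. It is what makes the scaling
  rules for the bracket below equations between vector fields, valid at all arguments.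
\<close>

lemma vector_fields_smooth:
  assumes "X \<in> vector_fields A"
  shows "(\<lambda>p. X p f) \<in> smooth_functions A"
proof (cases "f \<in> smooth_functions A")
  case True
  then show ?thesis using assms by (simp add: vector_fields_def)
next
  case False
  then have "(\<lambda>p. X p f) = (\<lambda>_. 0)"
    using vector_fields_not_smooth[OF assms] by blast
  then show ?thesis by (simp add: smooth_functions_const)
qed

lemma vector_fields_scale:
  "X \<in> vector_fields A \<Longrightarrow> f \<in> smooth_functions A \<Longrightarrow> X p (\<lambda>x. c * f x) = c * X p f"
  by (cases "p \<in> points A")
    (auto simp: vector_fields_outside dest: vector_fields_tangent tangent_space_scale)

lemma vector_fields_lincomb:
  assumes "smooth_manifold T A" and "X \<in> vector_fields A" and "Y \<in> vector_fields A"
  shows "(\<lambda>p f. c * X p f + d * Y p f) \<in> vector_fields A"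
proof -
  have "(\<lambda>p. c * X p f + d * Y p f) \<in> smooth_functions A" for f
    by (intro smooth_functions_lincomb[OF assms(1)] vector_fields_smooth assms)
  then show ?thesis
    using assms(2,3) by (auto simp: vector_fields_def intro!: tangent_space_lincomb)
qed

lemma vf_add_vector_fields:
  assumes "smooth_manifold T A" and "X \<in> vector_fields A" and "Y \<in> vector_fields A"
  shows "vf_add X Y \<in> vector_fields A"
  using vector_fields_lincomb[OF assms, of 1 1] by (simp add: vf_add_def)

lemma vf_diff_vector_fields:
  assumes "smooth_manifold T A" and "X \<in> vector_fields A" and "Y \<in> vector_fields A"
  shows "vf_diff X Y \<in> vector_fields A"
  using vector_fields_lincomb[OF assms, of 1 "-1"] by (simp add: vf_diff_def)

text \<open>
  In the Leibniz rule for the bracket the mixed terms \<open>X f * Y g + X g * Y f\<close> are symmetric in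
  \<open>X\<close> and \<open>Y\<close> and hence cancel.
\<close>

lemma lie_bracket_vector_fields:
  assumes M: "smooth_manifold T A" and X: "X \<in> vector_fields A" and Y: "Y \<in> vector_fields A"
  shows "lie_bracket X Y \<in> vector_fields A"
proof -
  have add: "Z p (\<lambda>q. W q (\<lambda>x. f x + g x)) = Z p (\<lambda>q. W q f) + Z p (\<lambda>q. W q g)"
    if Z: "Z \<in> vector_fields A" and W: "W \<in> vector_fields A" and p: "p \<in> points A"
      and f: "f \<in> smooth_functions A" and g: "g \<in> smooth_functions A" for Z W p f g
  proof -
    have "(\<lambda>q. W q (\<lambda>x. f x + g x)) = (\<lambda>q. W q f + W q g)"
      using tangent_space_add[OF vector_fields_tangent[OF W] f g] vector_fields_outside[OF W]
      by (metis add.right_neutral)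
    then show ?thesis
      using tangent_space_add[OF vector_fields_tangent[OF Z p]] vector_fields_smooth[OF W] by simp
  qed
  have scale: "Z p (\<lambda>q. W q (\<lambda>x. c * f x)) = c * Z p (\<lambda>q. W q f)"
    if Z: "Z \<in> vector_fields A" and W: "W \<in> vector_fields A" and f: "f \<in> smooth_functions A"
    for Z W p f c
    by (simp add: vector_fields_scale[OF W f] vector_fields_scale[OF Z vector_fields_smooth[OF W]])
  have mult: "Z p (\<lambda>q. W q (\<lambda>x. f x * g x)) =
      f p * Z p (\<lambda>q. W q g) + W p g * Z p f + (g p * Z p (\<lambda>q. W q f) + W p f * Z p g)"
    if Z: "Z \<in> vector_fields A" and W: "W \<in> vector_fields A" and p: "p \<in> points A"
      and f: "f \<in> smooth_functions A" and g: "g \<in> smooth_functions A" for Z W p f g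
  proof -
    have eq: "(\<lambda>q. W q (\<lambda>x. f x * g x)) = (\<lambda>q. f q * W q g + g q * W q f)"
    proof
      fix q
      show "W q (\<lambda>x. f x * g x) = f q * W q g + g q * W q f"
        using tangent_space_mult[OF vector_fields_tangent[OF W] f g] vector_fields_outside[OF W]
        by (cases "q \<in> points A") auto
    qed
    note Zp = vector_fields_tangent[OF Z p]
    have "Z p (\<lambda>q. f q * W q g + g q * W q f) = Z p (\<lambda>q. f q * W q g) + Z p (\<lambda>q. g q * W q f)"
      by (intro tangent_space_add[OF Zp] smooth_functions_mult[OF M] f g vector_fields_smooth[OF W])
    then show ?thesis
      unfolding eq using tangent_space_mult[OF Zp f vector_fields_smooth[OF W]]
        tangent_space_mult[OF Zp g vector_fields_smooth[OF W]] by simp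
  qed
  have "lie_bracket X Y p \<in> tangent_space A p" if "p \<in> points A" for p
    unfolding tangent_space_def lie_bracket_def
    using that X Y
    by (simp add: add scale mult vector_fields_not_smooth vector_fields_const algebra_simps)
  moreover have "(\<lambda>p. lie_bracket X Y p f) \<in> smooth_functions A" for f
    using smooth_functions_lincomb[OF M vector_fields_smooth[OF X] vector_fields_smooth[OF Y],
        of 1 _ "-1"]
    by (simp add: lie_bracket_def)
  ultimately show ?thesis
    using vector_fields_outside[OF X] vector_fields_outside[OF Y]
    by (auto simp: vector_fields_def lie_bracket_def)
qed

lemma lie_bracket_scale_left:
  "X \<in> vector_fields A \<Longrightarrow> Y \<in> vector_fields A \<Longrightarrow>
    lie_bracket (vf_mult (\<lambda>_. c) X) Y = vf_mult (\<lambda>_. c) (lie_bracket X Y)"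
  by (auto simp: lie_bracket_def vf_mult_def fun_eq_iff vector_fields_smooth
      vector_fields_scale[of Y A] algebra_simps)

lemma lie_bracket_scale_right:
  "X \<in> vector_fields A \<Longrightarrow> Y \<in> vector_fields A \<Longrightarrow>
    lie_bracket X (vf_mult (\<lambda>_. c) Y) = vf_mult (\<lambda>_. c) (lie_bracket X Y)"
  by (auto simp: lie_bracket_def vf_mult_def fun_eq_iff vector_fields_smooth
      vector_fields_scale[of X A] algebra_simps)


section \<open>Tensor fields and connections\<close>

lemma tensor_field_tangent:
  "tensor_field_1_1 A J \<Longrightarrow> p \<in> points A \<Longrightarrow> v \<in> tangent_space A p \<Longrightarrow> J p v \<in> tangent_space A p"
  by (simp add: tensor_field_1_1_def)

lemma tensor_field_lincomb:
  "tensor_field_1_1 A J \<Longrightarrow> p \<in> points A \<Longrightarrow> v \<in> tangent_space A p \<Longrightarrow> w \<in> tangent_space A p \<Longrightarrow>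
    J p (\<lambda>f. c * v f + d * w f) = (\<lambda>f. c * J p v f + d * J p w f)"
  by (simp add: tensor_field_1_1_def)

lemma vf_app_vector_fields:
  "tensor_field_1_1 A J \<Longrightarrow> X \<in> vector_fields A \<Longrightarrow> vf_app A J X \<in> vector_fields A"
  by (simp add: tensor_field_1_1_def)

lemma vf_app_scale:
  assumes "tensor_field_1_1 A J" and "X \<in> vector_fields A"
  shows "vf_app A J (vf_mult (\<lambda>_. c) X) = vf_mult (\<lambda>_. c) (vf_app A J X)"
proof -
  have "J p (\<lambda>f. c * X p f) = (\<lambda>f. c * J p (X p) f)" if "p \<in> points A" for p
    using tensor_field_lincomb[OF assms(1) that, of "X p" "X p" c 0] vector_fields_tangent[OF assms(2) that]
    by simp
  then show ?thesis
    by (auto simp: vf_app_def vf_mult_def fun_eq_iff)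
qed

lemma tensor_field_lincomb_identity:
  assumes "smooth_manifold T A" and J: "tensor_field_1_1 A J"
  shows "tensor_field_1_1 A (\<lambda>p v f. c * J p v f + d * v f)"
proof -
  have "vf_app A (\<lambda>p v f. c * J p v f + d * v f) X \<in> vector_fields A"
    if X: "X \<in> vector_fields A" for X
  proof -
    have "vf_app A (\<lambda>p v f. c * J p v f + d * v f) X =
        (\<lambda>p f. c * vf_app A J X p f + d * X p f)"
      using vector_fields_outside[OF X] by (auto simp: vf_app_def fun_eq_iff)
    then show ?thesis
      using vector_fields_lincomb[OF assms(1) vf_app_vector_fields[OF J X] X] by simp
  qed
  then show ?thesis
    unfolding tensor_field_1_1_def
    using tensor_field_lincomb[OF J] tensor_field_tangent[OF J]
    by (auto intro: tangent_space_lincomb simp: algebra_simps fun_eq_iff)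
qed

lemma proj_l_tensor_field:
  assumes "smooth_manifold T A" and "tensor_field_1_1 A J"
  shows "tensor_field_1_1 A (proj_l a b J)"
  using tensor_field_lincomb_identity[OF assms, of "1 / (2 * metallic_mean a b - real a)"
      "- ((real a - metallic_mean a b) / (2 * metallic_mean a b - real a))"]
  by (simp add: proj_l_def Let_def)

lemma proj_m_tensor_field:
  assumes "smooth_manifold T A" and "tensor_field_1_1 A J"
  shows "tensor_field_1_1 A (proj_m a b J)"
  using tensor_field_lincomb_identity[OF assms, of "- (1 / (2 * metallic_mean a b - real a))"
      "metallic_mean a b / (2 * metallic_mean a b - real a)"]
  by (simp add: proj_m_def Let_def)

lemma linear_connection_vector_fields:
  "linear_connection A D \<Longrightarrow> X \<in> vector_fields A \<Longrightarrow> Y \<in> vector_fields A \<Longrightarrow> D X Y \<in> vector_fields A"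
  by (simp add: linear_connection_def)

lemma linear_connection_scale_left:
  "linear_connection A D \<Longrightarrow> X \<in> vector_fields A \<Longrightarrow> Y \<in> vector_fields A \<Longrightarrow>
    D (vf_mult (\<lambda>_. c) X) Y = vf_mult (\<lambda>_. c) (D X Y)"
  by (simp add: linear_connection_def smooth_functions_const)

text \<open>For a constant factor the derivative term of the Leibniz rule vanishes.\<close>

lemma linear_connection_scale_right:
  assumes "linear_connection A D" and X: "X \<in> vector_fields A" and "Y \<in> vector_fields A"
  shows "D X (vf_mult (\<lambda>_. c) Y) = vf_mult (\<lambda>_. c) (D X Y)"
proof -
  have "D X (vf_mult (\<lambda>_. c) Y) = vf_add (vf_mult (\<lambda>p. X p (\<lambda>_. c)) Y) (vf_mult (\<lambda>_. c) (D X Y))"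
    using assms by (simp add: linear_connection_def smooth_functions_const)
  then show ?thesis
    by (simp add: vector_fields_const[OF X] vf_add_def vf_mult_def)
qed


section \<open>Anti half parallelism of eigendistributions\<close>

text \<open>
  The factor \<open>J - c\<close> of \<open>(\<Delta>J)(X, Y) = (J - c) (D X Y - D Y X)\<close> maps into the eigenspace for \<open>d\<close>
  because \<open>(J - d) (J - c) = 0\<close>; the hypothesis on \<open>J p (J p v)\<close> is
  this product multiplied out. Homogeneity of \<open>D\<close> serves to pull the
  eigenvalue out of \<open>D (J X) Y\<close> and \<open>D Y (J X)\<close>.
\<close>

lemma anti_half_parallel_eigendistributions:
  assumes M: "smooth_manifold T A" and J: "tensor_field_1_1 A J"
    and annihilated: "\<And>p v f. p \<in> points A \<Longrightarrow> v \<in> tangent_space A p \<Longrightarrow>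
      J p (J p v) f = (c + d) * J p v f - c * d * v f"
    and D: "\<And>X Y. X \<in> vector_fields A \<Longrightarrow> Y \<in> vector_fields A \<Longrightarrow> D X Y \<in> vector_fields A"
    and scale_left: "\<And>X Y. X \<in> vector_fields A \<Longrightarrow> Y \<in> vector_fields A \<Longrightarrow>
      D (vf_mult (\<lambda>_. c) X) Y = vf_mult (\<lambda>_. c) (D X Y)"
    and scale_right: "\<And>X Y. X \<in> vector_fields A \<Longrightarrow> Y \<in> vector_fields A \<Longrightarrow>
      D X (vf_mult (\<lambda>_. c) Y) = vf_mult (\<lambda>_. c) (D X Y)"
  shows "anti_half_parallel A J D (eigendistribution A J c) (eigendistribution A J d)"
  unfolding anti_half_parallel_def
proof (intro ballI)
  fix X Y
  assume "X \<in> sections A (eigendistribution A J c)" and Y: "Y \<in> vector_fields A"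
  then have X: "X \<in> vector_fields A" and eigen: "\<And>p. p \<in> points A \<Longrightarrow> J p (X p) = (\<lambda>f. c * X p f)"
    by (auto simp: sections_def eigendistribution_def)
  define Z where "Z = vf_diff (D X Y) (D Y X)"
  have Z: "Z \<in> vector_fields A"
    unfolding Z_def by (intro vf_diff_vector_fields[OF M] D X Y)
  have "vf_app A J X = vf_mult (\<lambda>_. c) X"
    using eigen vector_fields_outside[OF X] by (auto simp: vf_app_def vf_mult_def fun_eq_iff)
  moreover have "vf_app A J Z = vf_diff (vf_app A J (D X Y)) (vf_app A J (D Y X))"
  proof -
    have "J p (\<lambda>f. D X Y p f - D Y X p f) = (\<lambda>f. J p (D X Y p) f - J p (D Y X p) f)"
      if p: "p \<in> points A" for p
      using tensor_field_lincomb[OF J p vector_fields_tangent[OF D[OF X Y] p]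
          vector_fields_tangent[OF D[OF Y X] p], of 1 "-1"] by simp
    then show ?thesis
      by (auto simp: Z_def vf_app_def vf_diff_def fun_eq_iff)
  qed
  ultimately have Delta: "Delta A J D X Y = (\<lambda>p f. 1 * vf_app A J Z p f + (-c) * Z p f)"
    unfolding Delta_def Let_def
    by (simp only: scale_left[OF X Y] scale_right[OF Y X])
      (simp add: Z_def vf_add_def vf_diff_def vf_mult_def algebra_simps)
  have "Delta A J D X Y \<in> vector_fields A"
    unfolding Delta by (intro vector_fields_lincomb[OF M] vf_app_vector_fields[OF J] Z)
  moreover have "J p (Delta A J D X Y p) = (\<lambda>f. d * Delta A J D X Y p f)" if p: "p \<in> points A" for p
  proof -
    note Zp = vector_fields_tangent[OF Z p]
    have "J p (Delta A J D X Y p) = (\<lambda>f. 1 * J p (J p (Z p)) f + (-c) * J p (Z p) f)"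
      unfolding Delta using p tensor_field_lincomb[OF J p tensor_field_tangent[OF J p Zp] Zp, of 1 "-c"]
      by (simp add: vf_app_def)
    then show ?thesis
      using p by (simp add: annihilated[OF p Zp] Delta vf_app_def algebra_simps)
  qed
  ultimately show "Delta A J D X Y \<in> sections A (eigendistribution A J d)"
    by (simp add: sections_def eigendistribution_def vector_fields_tangent)
qed


section \<open>The Vranceanu connection\<close>

lemma vranceanu_connection_vector_fields:
  assumes M: "smooth_manifold T A" and J: "tensor_field_1_1 A J" and D: "linear_connection A D"
    and X: "X \<in> vector_fields A" and Y: "Y \<in> vector_fields A"
  shows "vranceanu_connection A a b J D X Y \<in> vector_fields A"
  unfolding vranceanu_connection_def Let_def
  by (intro vf_add_vector_fields[OF M] vf_app_vector_fields proj_l_tensor_field[OF M J]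
      proj_m_tensor_field[OF M J] lie_bracket_vector_fields[OF M]
      linear_connection_vector_fields[OF D] X Y)

lemma vf_mult_vf_add: "vf_mult h (vf_add X Y) = vf_add (vf_mult h X) (vf_mult h Y)"
  by (simp add: vf_mult_def vf_add_def algebra_simps)

lemma vranceanu_connection_scale_left:
  assumes M: "smooth_manifold T A" and J: "tensor_field_1_1 A J" and D: "linear_connection A D"
    and X: "X \<in> vector_fields A" and Y: "Y \<in> vector_fields A"
  shows "vranceanu_connection A a b J D (vf_mult (\<lambda>_. c) X) Y =
    vf_mult (\<lambda>_. c) (vranceanu_connection A a b J D X Y)"
proof -
  note l = proj_l_tensor_field[OF M J] and m = proj_m_tensor_field[OF M J]
  show ?thesis
    by (simp add: vranceanu_connection_def Let_def vf_mult_vf_add X Y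
        vf_app_scale[OF l] vf_app_scale[OF m] vf_app_vector_fields[OF l] vf_app_vector_fields[OF m]
        linear_connection_scale_left[OF D] linear_connection_vector_fields[OF D]
        lie_bracket_scale_left[of _ A] lie_bracket_vector_fields[OF M])
qed

lemma vranceanu_connection_scale_right:
  assumes M: "smooth_manifold T A" and J: "tensor_field_1_1 A J" and D: "linear_connection A D"
    and X: "X \<in> vector_fields A" and Y: "Y \<in> vector_fields A"
  shows "vranceanu_connection A a b J D X (vf_mult (\<lambda>_. c) Y) =
    vf_mult (\<lambda>_. c) (vranceanu_connection A a b J D X Y)"
proof -
  note l = proj_l_tensor_field[OF M J] and m = proj_m_tensor_field[OF M J]
  show ?thesis
    by (simp add: vranceanu_connection_def Let_def vf_mult_vf_add X Y
        vf_app_scale[OF l] vf_app_scale[OF m] vf_app_vector_fields[OF l] vf_app_vector_fields[OF m]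
        linear_connection_scale_right[OF D] linear_connection_vector_fields[OF D]
        lie_bracket_scale_right[of _ A] lie_bracket_vector_fields[OF M])
qed

lemma metallic_mean_conjugate_product:
  "metallic_mean a b * (real a - metallic_mean a b) = - real b"
proof -
  have "sqrt (real a ^ 2 + 4 * real b) ^ 2 = real a ^ 2 + 4 * real b"
    by simp
  then show ?thesis
    by (simp add: metallic_mean_def field_simps power2_eq_square)
qed

theorem proposition18:
  fixes T :: "'m topology"
    and A :: "('m, 'n::finite) atlas"
    and a b :: nat
    and J :: "'m endo_field"
    and D :: "'m connection"
  assumes "a > 0" and "b > 0"
    and "smooth_manifold T A"
    and "metallic_structure A a b J"
    and "linear_connection A D"
  shows "anti_half_parallel A J (vranceanu_connection A a b J D) (distr_L A a b J) (distr_M A a b J) \<and>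
         anti_half_parallel A J (vranceanu_connection A a b J D) (distr_M A a b J) (distr_L A a b J)"
proof -
  let ?\<rho> = "metallic_mean a b"
  note M = assms(3) and D = assms(5)
  have J: "tensor_field_1_1 A J"
    and metallic: "\<And>p v f. p \<in> points A \<Longrightarrow> v \<in> tangent_space A p \<Longrightarrow>
      J p (J p v) f = real a * J p v f + real b * v f"
    using assms(4) by (auto simp: metallic_structure_def)
  have "anti_half_parallel A J (vranceanu_connection A a b J D)
      (eigendistribution A J c) (eigendistribution A J d)"
    if "c + d = real a" and "c * d = - real b" for c d
    by (rule anti_half_parallel_eigendistributions[OF M J])
      (simp_all add: that metallic vranceanu_connection_vector_fields[OF M J D]
        vranceanu_connection_scale_left[OF M J D] vranceanu_connection_scale_right[OF M J D])
  from this[of ?\<rho> "real a - ?\<rho>"] this[of "real a - ?\<rho>" ?\<rho>] show ?thesis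
    using metallic_mean_conjugate_product[of a b]
    by (simp add: distr_L_def distr_M_def mult.commute)
qed

end
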